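(* Let $\mathbb{B}$ be a complete Boolean algebra satisfying the countable chain condition (ccc). Then every closed set $F$ in the space $\langle \mathbb{B},\mathcal{O}^\uparrow\rangle$ can be represented as $$F=\bigcup_{b\in \mathrm{Min}(F)} b\uparrow,$$ where $\mathrm{Min}(F)=\{b\in F : b \text{ is a minimal element of } F\}$.
   Context: For a complete Boolean algebra $\mathbb{B}$ and a sequence $x=\langle x_n:n\in\omega\rangle$ in $\mathbb{B}$, $\limsup x=\bigwedge_{k\in\omega}\bigvee_{n\ge k}x_n$. For $b\in\mathbb{B}$, $b\uparrow=\{c\in\mathbb{B}: b\le c\}$. The topology $\mathcal{O}^\uparrow$ on $\mathbb{B}$ is the topology generated by the convergence $x\mapsto\{\limsup x\}$: a set $O\subset\mathbb{B}$ is open iff for every sequence $x$ in $\mathbb{B}$ with $\limsup x\in O$ there is $n_0\in\omega$ such that $x_n\in O$ for all $n\ge n_0$. $\mathbb{B}$ is ccc iff every set of pairwise disjoint non-zero elements of $\mathbb{B}$ is at most countable. Minimality is with respect to the order $\le$ of $\mathbb{B}$ restricted to $F$. *)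

theory Defs
  imports "HOL-Analysis.Analysis"
begin

text \<open>
  Complete Boolean algebras are types of sort \<open>{boolean_algebra, complete_lattice}\<close>. The library
  class \<open>complete_boolean_algebra\<close> is deliberately not used: it extends
  \<open>complete_distrib_lattice\<close> and hence demands complete distributivity, which restricts it to
  atomic algebras.
\<close>

definition ccc :: "'a::boolean_algebra itself \<Rightarrow> bool" where
  "ccc _ \<longleftrightarrow>
     (\<forall>A :: 'a set. (\<forall>a\<in>A. a \<noteq> bot) \<and> pairwise (\<lambda>a b. inf a b = bot) A \<longrightarrow> countable A)"

text \<open>
  The library's \<open>limsup\<close> is available in every complete lattice and is the infimum over \<open>k\<close> of the
  suprema over \<open>n \<ge> k\<close> by \<open>limsup_INF_SUP\<close>.
\<close>

definition limsup_topology :: "'a::{boolean_algebra, complete_lattice} topology" where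
  "limsup_topology = topology (\<lambda>U. \<forall>x :: nat \<Rightarrow> 'a. limsup x \<in> U \<longrightarrow> (\<exists>n0. \<forall>n\<ge>n0. x n \<in> U))"

lemma openin_limsup_topology:
  "openin limsup_topology U \<longleftrightarrow>
     (\<forall>x :: nat \<Rightarrow> 'a::{boolean_algebra, complete_lattice}.
        limsup x \<in> U \<longrightarrow> (\<exists>n0. \<forall>n\<ge>n0. x n \<in> U))"
proof -
  have "istopology (\<lambda>U. \<forall>x :: nat \<Rightarrow> 'a. limsup x \<in> U \<longrightarrow> (\<exists>n0. \<forall>n\<ge>n0. x n \<in> U))"
    unfolding istopology_def
  proof (intro conjI allI impI)
    fix S T :: "'a set" and x :: "nat \<Rightarrow> 'a"
    assume S: "\<forall>x. limsup x \<in> S \<longrightarrow> (\<exists>n0. \<forall>n\<ge>n0. x n \<in> S)"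
      and T: "\<forall>x. limsup x \<in> T \<longrightarrow> (\<exists>n0. \<forall>n\<ge>n0. x n \<in> T)"
      and x: "limsup x \<in> S \<inter> T"
    obtain m where m: "\<forall>n\<ge>m. x n \<in> S" using S x by blast
    obtain k where k: "\<forall>n\<ge>k. x n \<in> T" using T x by blast
    have "\<forall>n\<ge>max m k. x n \<in> S \<inter> T" using m k by simp
    then show "\<exists>n0. \<forall>n\<ge>n0. x n \<in> S \<inter> T" by blast
  next
    fix K :: "'a set set" and x :: "nat \<Rightarrow> 'a"
    assume "\<forall>U\<in>K. \<forall>x. limsup x \<in> U \<longrightarrow> (\<exists>n0. \<forall>n\<ge>n0. x n \<in> U)" "limsup x \<in> \<Union>K"
    then show "\<exists>n0. \<forall>n\<ge>n0. x n \<in> \<Union>K" by (meson UnionE UnionI)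
  qed
  then show ?thesis by (simp add: limsup_topology_def)
qed

lemma topspace_limsup_topology [simp]: "topspace limsup_topology = UNIV"
proof -
  have "openin limsup_topology UNIV" by (simp add: openin_limsup_topology)
  then show ?thesis using openin_subset by blast
qed

definition Minimals :: "'a::order set \<Rightarrow> 'a set" where
  "Minimals F = {b \<in> F. \<forall>c\<in>F. c \<le> b \<longrightarrow> c = b}"

end

theory Submission
  imports Defs
begin

text \<open>
  Closed sets are upward closed (alternate the two elements) and closed under infima of decreasing
  sequences. By ccc the infimum of a chain \<open>C\<close> is the infimum of a countable subset: take a maximal
  antichain of non-zero elements lying below complements of members of \<open>C\<close>, and for each of them
  one such member. Hence it is the infimum of a decreasing sequence from \<open>C\<close>, and Zorn's lemma
  yields a minimal element of \<open>F\<close> below every element of \<open>F\<close>.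
\<close>

text \<open>If the limsup lay in the open set \<open>- F\<close>, the sequence would eventually
  avoid \<open>F\<close>. Visiting \<open>F\<close> infinitely often is therefore enough, which
  allows sequences with only some terms in \<open>F\<close>.\<close>

lemma closedin_limsup_topology_limsup:
  fixes F :: "'a::{boolean_algebra, complete_lattice} set"
  assumes "closedin limsup_topology F" and "\<exists>\<^sub>F n in sequentially. x n \<in> F"
  shows "limsup x \<in> F"
proof (rule ccontr)
  assume "limsup x \<notin> F"
  moreover have "openin limsup_topology (- F)"
    using assms(1) by (simp add: closedin_def Compl_eq_Diff_UNIV)
  ultimately have "\<exists>n0. \<forall>n\<ge>n0. x n \<in> - F"
    unfolding openin_limsup_topology by blast
  then show False
    using assms(2) by (auto simp: frequently_def eventually_sequentially)
qed

text \<open>Each tail of a decreasing sequence has its first term as supremum.\<close>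

lemma limsup_decseq:
  fixes x :: "nat \<Rightarrow> 'a::complete_lattice"
  assumes "decseq x"
  shows "limsup x = (INF n. x n)"
proof -
  have "(SUP n\<in>{k..}. x n) = x k" for k
    by (rule antisym) (auto intro!: SUP_least SUP_upper decseqD[OF assms])
  then show ?thesis
    by (simp add: limsup_INF_SUP)
qed

lemma limsup_alternating:
  fixes a b :: "'a::complete_lattice"
  shows "limsup (\<lambda>n. if even n then a else b) = sup a b"
proof -
  have "(SUP n\<in>{k..}. if even n then a else b) = sup a b" for k :: nat
  proof (rule antisym)
    show "(SUP n\<in>{k..}. if even n then a else b) \<le> sup a b"
      by (rule SUP_least) auto
    have "a \<le> (SUP n\<in>{k..}. if even n then a else b)"
      by (rule SUP_upper2[of "2 * k"]) auto
    moreover have "b \<le> (SUP n\<in>{k..}. if even n then a else b)"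
      by (rule SUP_upper2[of "2 * k + 1"]) auto
    ultimately show "sup a b \<le> (SUP n\<in>{k..}. if even n then a else b)"
      by simp
  qed
  then show ?thesis
    by (simp add: limsup_INF_SUP)
qed

text \<open>The sequence alternating between \<open>a\<close> and \<open>b\<close> meets
  \<open>F\<close> at every even index, and its limsup is \<open>sup a b = b\<close>.\<close>

lemma closedin_limsup_topology_upward:
  fixes F :: "'a::{boolean_algebra, complete_lattice} set"
  assumes "closedin limsup_topology F" and "a \<in> F" and "a \<le> b"
  shows "b \<in> F"
proof -
  have "\<exists>\<^sub>F n::nat in sequentially. (if even n then a else b) \<in> F"
    unfolding frequently_sequentially
  proof
    fix n :: nat
    show "\<exists>m\<ge>n. (if even m then a else b) \<in> F"
      using assms(2) by (intro exI[of _ "2 * n"]) auto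
  qed
  from closedin_limsup_topology_limsup[OF assms(1) this] show ?thesis
    using assms(3) by (simp add: limsup_alternating sup.absorb2)
qed

text \<open>Zorn's lemma for inclusion. As \<open>R\<close> need not be symmetric, the maximality
  clause asks for both directions.\<close>

lemma maximal_pairwise_subset:
  obtains W where "W \<subseteq> P" "pairwise R W"
    "\<forall>e\<in>P. (\<forall>w\<in>W. R e w \<and> R w e) \<longrightarrow> e \<in> W"
proof -
  let ?S = "{W. W \<subseteq> P \<and> pairwise R W}"
  have "\<exists>M\<in>?S. \<forall>X\<in>?S. M \<subseteq> X \<longrightarrow> X = M"
  proof (rule Zorn_Lemma, rule ballI)
    fix K assume K: "K \<in> chains ?S"
    then have sub: "K \<subseteq> ?S" and "chain\<^sub>\<subseteq> K"
      by (simp_all add: chains_def)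
    have "pairwise R (\<Union>K)"
      using sub by (intro pairwise_chain_Union[OF _ \<open>chain\<^sub>\<subseteq> K\<close>]) auto
    then show "\<Union>K \<in> ?S"
      using sub by blast
  qed
  then obtain W where W: "W \<subseteq> P" "pairwise R W"
    and max: "\<forall>X\<in>?S. W \<subseteq> X \<longrightarrow> X = W"
    by auto
  show thesis
  proof (rule that[OF W], intro ballI impI)
    fix e assume "e \<in> P" "\<forall>w\<in>W. R e w \<and> R w e"
    then have "insert e W = W"
      using W by (intro max[rule_format]) (auto simp: pairwise_insert)
    then show "e \<in> W" by blast
  qed
qed

lemma ccc_countable_coinitial:
  fixes C :: "'a::{boolean_algebra, complete_lattice} set"
  assumes "ccc TYPE('a)"
  obtains D where "D \<subseteq> C" "countable D" "Inf D = Inf C"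
proof -
  let ?P = "{w. w \<noteq> bot \<and> (\<exists>c\<in>C. w \<le> - c)}"
  obtain W where W: "W \<subseteq> ?P" and disj: "pairwise (\<lambda>a b. inf a b = bot) W"
    and max: "\<forall>e\<in>?P. (\<forall>w\<in>W. inf e w = bot \<and> inf w e = bot) \<longrightarrow> e \<in> W"
    by (rule maximal_pairwise_subset)
  have "countable W"
    using assms W disj unfolding ccc_def by blast
  have "\<forall>w\<in>W. \<exists>c\<in>C. w \<le> - c"
    using W by blast
  then obtain g where g: "\<And>w. w \<in> W \<Longrightarrow> g w \<in> C" "\<And>w. w \<in> W \<Longrightarrow> w \<le> - g w"
    by metis
  have "Inf (g ` W) \<le> c" if "c \<in> C" for c
  proof (rule ccontr)
    \<comment> \<open>If \<open>e\<close> is non-zero, it belongs to \<open>?P\<close> by way of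
      \<open>c\<close>. It is disjoint from each \<open>w\<close> in \<open>W\<close>, since
      \<open>e \<le> g w \<le> - w\<close>. Maximality then puts \<open>e\<close> into
      \<open>W\<close>, so \<open>e\<close> is disjoint from itself.\<close>
    define e where "e = inf (Inf (g ` W)) (- c)"
    assume "\<not> Inf (g ` W) \<le> c"
    then have "e \<noteq> bot"
      by (simp add: e_def inf_shunt)
    have ew: "inf e w = bot" if "w \<in> W" for w
    proof -
      have "e \<le> g w"
        unfolding e_def using that by (intro le_infI1 INF_lower)
      also have "g w \<le> - w"
        using g(2)[OF that] compl_le_swap1 by blast
      finally show ?thesis
        by (simp add: inf_shunt)
    qed
    have "e \<le> - c"
      by (simp add: e_def)
    then have "e \<in> W"
      using \<open>e \<noteq> bot\<close> \<open>c \<in> C\<close> ew by (intro max[rule_format]) (auto simp: inf_commute)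
    then show False
      using ew[of e] \<open>e \<noteq> bot\<close> by simp
  qed
  then have "Inf (g ` W) \<le> Inf C"
    by (rule Inf_greatest)
  moreover have "Inf C \<le> Inf (g ` W)"
    using g(1) by (intro Inf_superset_mono) blast
  ultimately have "Inf (g ` W) = Inf C"
    by (rule antisym)
  then show thesis
    using g(1) \<open>countable W\<close> by (intro that[of "g ` W"]) auto
qed

text \<open>Take the running infima of an enumeration of \<open>D\<close>. They stay in
  \<open>D\<close> because the infimum of two comparable elements is one of them.\<close>

lemma countable_chain_decseq:
  fixes D :: "'a::complete_lattice set"
  assumes "countable D" "D \<noteq> {}" and chain: "\<And>a b. \<lbrakk>a \<in> D; b \<in> D\<rbrakk> \<Longrightarrow> a \<le> b \<or> b \<le> a"
  obtains y where "decseq y" "range y \<subseteq> D" "(INF n. y n) = Inf D"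
proof -
  \<comment> \<open>The enumeration may repeat elements, so a finite \<open>D\<close> is covered
    too.\<close>
  define f where "f = from_nat_into D"
  have f: "range f = D"
    unfolding f_def using assms by (simp add: range_from_nat_into)
  define y where "y = rec_nat (f 0) (\<lambda>n z. inf z (f (Suc n)))"
  have y: "y 0 = f 0" "y (Suc n) = inf (y n) (f (Suc n))" for n
    by (simp_all add: y_def)
  have yD: "y n \<in> D" for n
  proof (induction n)
    case 0
    then show ?case using f y by auto
  next
    case (Suc n)
    moreover have "f (Suc n) \<in> D" using f by blast
    ultimately show ?case
      using chain[of "y n" "f (Suc n)"] by (auto simp: y inf.absorb1 inf.absorb2)
  qed
  have "y n \<le> f n" for n
    by (cases n) (simp_all add: y)
  then have "(INF n. y n) \<le> (INF n. f n)"
    by (intro INF_mono) auto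
  moreover have "Inf D \<le> (INF n. y n)"
    using yD by (intro INF_greatest Inf_lower)
  ultimately have "(INF n. y n) = Inf D"
    by (simp add: f antisym)
  moreover have "decseq y"
    by (rule decseq_SucI) (simp add: y)
  ultimately show thesis
    using yD by (intro that) auto
qed

lemma closedin_limsup_topology_Inf_chain:
  fixes F :: "'a::{boolean_algebra, complete_lattice} set"
  assumes "ccc TYPE('a)" and "closedin limsup_topology F"
    and "C \<subseteq> F" "C \<noteq> {}" and chain: "\<And>a b. \<lbrakk>a \<in> C; b \<in> C\<rbrakk> \<Longrightarrow> a \<le> b \<or> b \<le> a"
  shows "Inf C \<in> F"
proof -
  obtain D where D: "D \<subseteq> C" "countable D" "Inf D = Inf C"
    by (rule ccc_countable_coinitial[OF assms(1)])
  show ?thesis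
  \<comment> \<open>An empty \<open>D\<close> arises when \<open>C = {top}\<close>; there is then no
    sequence to draw from \<open>D\<close>, and upward closure gives \<open>top\<close> in
    \<open>F\<close>.\<close>
  proof (cases "D = {}")
    case True
    then have "Inf C = top" using D by simp
    moreover obtain c where "c \<in> F" using assms(3,4) by blast
    ultimately show ?thesis
      using closedin_limsup_topology_upward[OF assms(2) _ top_greatest] by metis
  next
    case False
    obtain y where y: "decseq y" "range y \<subseteq> D" "(INF n. y n) = Inf D"
      using countable_chain_decseq[OF D(2) False] chain D(1) by blast
    have "\<And>n. y n \<in> F"
      using y(2) D(1) assms(3) by blast
    then have "limsup y \<in> F"
      by (intro closedin_limsup_topology_limsup[OF assms(2)]) (simp add: frequently_sequentially; blast)
    then show ?thesis
      using y D by (simp add: limsup_decseq)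
  qed
qed

text \<open>Zorn's lemma is applied to the reversed order on the part of \<open>F\<close> below
  \<open>a\<close>. A minimal element \<open>m\<close> of that part is minimal in \<open>F\<close>,
  since anything below \<open>m\<close> is also below \<open>a\<close>.\<close>

lemma closedin_limsup_topology_minimal_below:
  fixes F :: "'a::{boolean_algebra, complete_lattice} set"
  assumes "ccc TYPE('a)" and "closedin limsup_topology F" and "a \<in> F"
  obtains b where "b \<in> Minimals F" "b \<le> a"
proof -
  let ?A = "{c \<in> F. c \<le> a}"
  have "\<exists>m\<in>?A. \<forall>c\<in>?A. m \<ge> c \<longrightarrow> c = m"
  proof (rule predicate_Zorn)
    show "partial_order_on ?A (relation_of (\<ge>) ?A)"
      by (rule partial_order_on_relation_ofI) auto
  next
    fix C assume C: "C \<in> Chains (relation_of (\<ge>) ?A)"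
    show "\<exists>u\<in>?A. \<forall>c\<in>C. c \<ge> u"
    proof (cases "C = {}")
      case True
      \<comment> \<open>The empty chain is bounded by \<open>a\<close>; its infimum
        \<open>top\<close> need not lie below \<open>a\<close>.\<close>
      then show ?thesis using assms(3) by auto
    next
      case False
      have CA: "C \<subseteq> ?A"
        using C by (auto simp: Chains_def relation_of_def)
      have "Inf C \<in> F"
        using C CA False
        by (intro closedin_limsup_topology_Inf_chain[OF assms(1,2)])
          (auto simp: Chains_def relation_of_def)
      moreover have "Inf C \<le> a"
        using CA False by (blast intro: order_trans[OF Inf_lower])
      ultimately show ?thesis
        by (auto intro: Inf_lower)
    qed
  qed
  then obtain m where "m \<in> F" "m \<le> a" "\<And>c. \<lbrakk>c \<in> F; c \<le> a; c \<le> m\<rbrakk> \<Longrightarrow> c = m"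
    by blast
  then show thesis
    by (intro that[of m]) (auto simp: Minimals_def dest: order_trans[OF _ \<open>m \<le> a\<close>])
qed

theorem theorem4p14:
  fixes F :: "'a::{boolean_algebra, complete_lattice} set"
  assumes "ccc TYPE('a)"
    and "closedin limsup_topology F"
  shows "F = (\<Union>b\<in>Minimals F. {b..})"
proof (intro subset_antisym subsetI)
  fix a assume "a \<in> F"
  then obtain b where "b \<in> Minimals F" "b \<le> a"
    by (rule closedin_limsup_topology_minimal_below[OF assms])
  then show "a \<in> (\<Union>b\<in>Minimals F. {b..})"
    by auto
next
  fix a assume "a \<in> (\<Union>b\<in>Minimals F. {b..})"
  then show "a \<in> F"
    using closedin_limsup_topology_upward[OF assms(2)] by (auto simp: Minimals_def)
qed

end
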